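(* For each $d\in\{2,3\}$ there exist convex, centrally symmetric bodies $\mathcal{P},Q\subset\mathbb{R}^d$ of positive measure, neither of which is a multi-tiler, such that $$\widehat{\mathbf{1}_{\mathcal{P}}}(n)=\widehat{\mathbf{1}_{Q}}(n)\qquad\text{for every }n\in\mathbb{Z}^d,$$ but $\mathcal{P}$ and $Q$ do not agree up to a rigid motion and a set of measure zero; that is, there is no rigid motion $T$ of $\mathbb{R}^d$ for which the symmetric difference of $T(\mathcal{P})$ and $Q$ has Lebesgue measure zero.
   Context: A body is a compact subset of $\mathbb{R}^d$ with nonempty interior. A set $\mathcal{K}\subset\mathbb{R}^d$ is centrally symmetric if there is $c\in\mathbb{R}^d$ with $\mathcal{K}=2c-\mathcal{K}$. A rigid motion is an isometry of Euclidean space $\mathbb{R}^d$. A measurable set $\mathcal{K}\subset\mathbb{R}^d$ is called a multi-tiler if there are a discrete translation multiset $\Lambda\subset\mathbb{R}^d$ (not necessarily a lattice) and a positive integer $k$ such that $\sum_{\lambda\in\Lambda}\mathbf{1}_{\mathcal{K}}(x-\lambda)=k$ for almost every $x\in\mathbb{R}^d$ (elements of $\Lambda$ counted with multiplicity). For a measurable set $\mathcal{K}\subset\mathbb{R}^d$ of finite measure, $\widehat{\mathbf{1}_{\mathcal{K}}}(\xi):=\int_{\mathcal{K}}e^{-2\pi i\langle x,\xi\rangle}\,dx$ for $\xi\in\mathbb{R}^d$. *)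

theory Defs
  imports "HOL-Analysis.Analysis"
begin

definition body :: "'a::euclidean_space set \<Rightarrow> bool" where
  "body K \<longleftrightarrow> compact K \<and> interior K \<noteq> {}"

definition centrally_symmetric :: "'a::euclidean_space set \<Rightarrow> bool" where
  "centrally_symmetric K \<longleftrightarrow> (\<exists>c. K = (\<lambda>x. 2 *\<^sub>R c - x) ` K)"

(* Surjectivity is automatic for distance-preserving self-maps of a Euclidean space;
   orientation-reversing isometries are included. *)
definition rigid_motion :: "('a::euclidean_space \<Rightarrow> 'a) \<Rightarrow> bool" where
  "rigid_motion T \<longleftrightarrow> (\<forall>x y. dist (T x) (T y) = dist x y)"

(* A possibly infinite multiset of translations is given by its multiplicity function m, since
   the library type of multisets only has finite ones. Its support carries the subspace-discrete
   topology; no lattice structure is required. Since the values are nonnegative, has_sum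
   means that the unordered series converges with the stated value. *)
definition multi_tiler :: "'a::euclidean_space set \<Rightarrow> bool" where
  "multi_tiler K \<longleftrightarrow> K \<in> sets lebesgue \<and>
     (\<exists>(m :: 'a \<Rightarrow> nat) (k :: nat).
        discrete {l. m l > 0} \<and> k > 0 \<and>
        (AE x in lebesgue.
           ((\<lambda>l. real (m l) * indicator K (x - l)) has_sum real k) {l. m l > 0}))"

definition fourier_indicator :: "'a::euclidean_space set \<Rightarrow> 'a \<Rightarrow> complex" where
  "fourier_indicator K \<xi> =
     (LINT x:K|lebesgue. exp (- 2 * complex_of_real pi * \<i> * complex_of_real (x \<bullet> \<xi>)))"

definition integer_points :: "(real ^ 'n) set" where
  "integer_points = {x. \<forall>i. x $ i \<in> \<int>}"

end

theory Submission
  imports Defs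
begin

text \<open>Fourier coefficients at integer points only see the periodization of a set, so cutting a body
  into pieces and moving them by integer vectors does not change them. Take the rectangle
  \<open>\<bar>X\<bar> \<le> 3\<close>, \<open>\<bar>Y\<bar> \<le> 1/2\<close> with a parabolic cap on its left and right side. Its vertical chords
  have length 1, so shearing it to \<open>\<bar>Y - X/3\<bar> \<le> 1/2\<close> is a piecewise integer translation, which
  displaces the caps by the integer vectors \<open>(0, 1)\<close> and \<open>(0, -1)\<close>. The caps are flat enough for the
  sheared body to be convex, and its circumradius is larger. In higher dimension take the product with a cube.

  A curved boundary forbids multi-tiling: along a generic curve in one cap of a translate,
  only translates lying on the same side of the boundary can share it, because two different translates
  of the planar boundary meet the arc in finitely many points. Hence the number of translates
  covering a point jumps across that boundary.\<close>

section \<open>Covering numbers of multi-tilings\<close>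

lemma AE_lebesgue_meets_open:
  fixes S :: "'a::euclidean_space set"
  assumes "AE x in lebesgue. R x" "open S" "S \<noteq> {}"
  obtains x where "x \<in> S" "R x"
proof -
  from assms(1) obtain N where N: "{x. \<not> R x} \<subseteq> N" "N \<in> null_sets lebesgue"
    by (auto simp: eventually_ae_filter)
  have "\<not> negligible S"
    using assms(2,3) open_not_negligible by blast
  then have "\<not> S \<subseteq> N"
    using N(2) negligible_iff_null_sets negligible_subset by blast
  then show ?thesis
    using N(1) that by blast
qed

lemma has_sum_real_nat_card_le:
  assumes "((\<lambda>l. real (m l) * indicator K (x - l)) has_sum real k) {l. m l > 0}"
    and "finite F" "F \<subseteq> {l. m l > 0}" "\<And>l. l \<in> F \<Longrightarrow> x - l \<in> K"
  shows "card F \<le> k"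
proof -
  have "real (card F) = (\<Sum>l\<in>F. 1)"
    by simp
  also have "\<dots> \<le> (\<Sum>l\<in>F. real (m l) * indicator K (x - l))"
    using assms(3,4) by (intro sum_mono) (auto simp: Suc_le_eq)
  also have "\<dots> \<le> real k"
    using assms(1-3) by (intro finite_sum_le_has_sum) auto
  finally show ?thesis
    by simp
qed

text \<open>Discreteness of the support alone would let it accumulate at points outside it. The
  interior of \<open>K\<close> rules this out: if more than \<open>k\<close> translation vectors
  clustered, their translates would share an open set, whose points would be covered too
  often.\<close>

lemma locally_finite_translations:
  fixes K :: "'a::euclidean_space set"
  assumes tile: "AE x in lebesgue.
      ((\<lambda>l. real (m l) * indicator K (x - l)) has_sum real k) {l. m l > 0}"
    and int: "interior K \<noteq> {}"
  shows "finite ({l. m l > 0} \<inter> cball y R)"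
proof -
  obtain z r where r: "r > 0" "ball z r \<subseteq> K"
    using int by (meson ex_in_conv interior_subset open_contains_ball open_interior subset_trans)
  \<comment> \<open>If \<open>ball z r \<subseteq> K\<close>, the translates by all vectors near \<open>w\<close> cover the points near \<open>w + z\<close>.\<close>
  have small: "finite ({l. m l > 0} \<inter> ball w (r/2))" for w
  proof (rule ccontr)
    assume "infinite ({l. m l > 0} \<inter> ball w (r/2))"
    then obtain F where F: "finite F" "card F = Suc k" "F \<subseteq> {l. m l > 0} \<inter> ball w (r/2)"
      by (meson infinite_arbitrarily_large)
    obtain x where x: "x \<in> ball (w + z) (r/2)"
      "((\<lambda>l. real (m l) * indicator K (x - l)) has_sum real k) {l. m l > 0}"
      using tile r by (rule_tac AE_lebesgue_meets_open[OF tile, of "ball (w+z) (r/2)"]) auto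
    have "x - l \<in> K" if "l \<in> F" for l
    proof -
      have "dist w l < r/2"
        using F(3) that by auto
      moreover have "dist (w + z) x < r/2"
        using x(1) by simp
      moreover have "z - (x - l) = ((w + z) - x) - (w - l)"
        by simp
      ultimately have "dist z (x - l) < r"
        unfolding dist_norm by (smt (verit) norm_triangle_ineq4 field_sum_of_halves)
      then show ?thesis
        using r(2) by auto
    qed
    then have "card F \<le> k"
      using has_sum_real_nat_card_le[OF x(2) F(1)] F(3) by auto
    then show False
      using F(2) by simp
  qed
  have "cball y R \<subseteq> (\<Union>w\<in>cball y R. ball w (r/2))"
    using r by auto
  then obtain W where W: "W \<subseteq> cball y R" "finite W" "cball y R \<subseteq> (\<Union>w\<in>W. ball w (r/2))"
    by (rule compactE_image[OF compact_cball, rotated]) auto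
  have "{l. m l > 0} \<inter> cball y R \<subseteq> (\<Union>w\<in>W. {l. m l > 0} \<inter> ball w (r/2))"
    using W(3) by auto
  then show ?thesis
    using W(2) small by (meson finite_UN finite_subset)
qed

text \<open>The quantified condition in the last premise excludes the harmless translates, those which near the point
  lie inside \<open>K\<close> and so cannot compensate the jump of the covering number across its frontier.\<close>

lemma not_multi_tiler_if_unshared_frontier:
  fixes K :: "'a::euclidean_space set" and \<gamma> :: "real \<Rightarrow> 'a"
  assumes "compact K" "convex K" "interior K \<noteq> {}" "uncountable U"
    and frontier: "\<And>t. t \<in> U \<Longrightarrow> \<gamma> t \<in> frontier K"
    and shared: "\<And>v. countable {t \<in> U. \<gamma> t - v \<in> frontier K \<and>
                    \<not> (\<exists>e>0. \<forall>x \<in> ball (\<gamma> t) e. x - v \<in> K \<longrightarrow> x \<in> K)}"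
  shows "\<not> multi_tiler K"
proof
  assume "multi_tiler K"
  then obtain m :: "'a \<Rightarrow> nat" and k :: nat where "k > 0" and
    tile: "AE x in lebesgue.
      ((\<lambda>l. real (m l) * indicator K (x - l)) has_sum real k) {l. m l > 0}"
    by (auto simp: multi_tiler_def)
  let ?L = "{l. m l > 0}"
  let ?S = "\<lambda>x. ((\<lambda>l. real (m l) * indicator K (x - l)) has_sum real k) ?L"
  have closed: "closed K"
    using assms(1) by (rule compact_imp_closed)
  have fin: "finite (?L \<inter> cball y R)" for y R
    using locally_finite_translations[OF tile assms(3)] .
  have "?L \<subseteq> (\<Union>n::nat. ?L \<inter> cball 0 (real n))"
    by (auto simp: real_arch_simple)
  moreover have "countable (\<Union>n::nat. ?L \<inter> cball 0 (real n))"
    using fin by (intro countable_UN countableI_type countable_finite)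
  ultimately have "countable ?L"
    by (rule countable_subset)
  obtain x0 where "?S x0"
    using AE_lebesgue_meets_open[OF tile, of UNIV] by auto
  then have "?L \<noteq> {}"
    using \<open>k > 0\<close> by (metis has_sum_empty has_sum_unique of_nat_0_eq_iff less_irrefl)
  then obtain a where a: "m a > 0"
    by auto
  define B where "B v = {t \<in> U. \<gamma> t - v \<in> frontier K \<and>
                    \<not> (\<exists>e>0. \<forall>x \<in> ball (\<gamma> t) e. x - v \<in> K \<longrightarrow> x \<in> K)}" for v
  \<comment> \<open>The bad parameters of all translates together are countable, so the uncountable
    \<open>U\<close> contains one that is good for every \<open>l\<close> at once.\<close>
  have "countable (\<Union>l\<in>?L. B (l - a))"
    using \<open>countable ?L\<close> shared by (simp add: B_def)
  then have "U - (\<Union>l\<in>?L. B (l - a)) \<noteq> {}"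
    using assms(4) by (metis Diff_eq_empty_iff countable_subset)
  then obtain t where t: "t \<in> U" "\<And>l. m l > 0 \<Longrightarrow> t \<notin> B (l - a)"
    by auto
  obtain C where C: "\<And>x. x \<in> K \<Longrightarrow> norm x \<le> C"
    using compact_imp_bounded[OF assms(1)] by (auto simp: bounded_iff)
  \<comment> \<open>Only translates meeting the unit ball around \<open>a + \<gamma> t\<close>
    matter below; the bound \<open>C\<close> on \<open>K\<close> confines their vectors to a finite
    set.\<close>
  define N where "N = ?L \<inter> cball (a + \<gamma> t) (C + 1)"
  have N: "l \<in> N" if "m l > 0" "x \<in> ball (\<gamma> t) 1" "a + x - l \<in> K" for l x
  proof -
    have "norm (a + x - l) \<le> C" "norm (\<gamma> t - x) < 1"
      using that C by (auto simp: dist_norm)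
    moreover have "a + \<gamma> t - l = (a + x - l) + (\<gamma> t - x)"
      by simp
    ultimately have "norm (a + \<gamma> t - l) \<le> C + 1"
      by (smt (verit) norm_triangle_ineq)
    then show ?thesis
      using that by (simp add: N_def dist_norm)
  qed
  \<comment> \<open>Near \<open>a + \<gamma> t\<close>, a translate that covers a point outside
    \<open>a + K\<close> covers all nearby points. If \<open>a + \<gamma> t\<close> is on its
    frontier, it locally lies inside \<open>a + K\<close> and the claim is vacuous; otherwise its
    indicator is locally constant.\<close>
  have ex: "\<exists>e>0. \<forall>x \<in> ball (\<gamma> t) e. \<forall>y \<in> ball (\<gamma> t) e. x \<notin> K \<longrightarrow> a + x - l \<in> K \<longrightarrow> a + y - l \<in> K"
    if "l \<in> N" for l
  proof (cases "\<gamma> t - (l - a) \<in> frontier K")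
    case True
    moreover have "t \<notin> B (l - a)"
      using t(2) that by (simp add: N_def)
    ultimately obtain e where "e > 0" "\<forall>x \<in> ball (\<gamma> t) e. x - (l - a) \<in> K \<longrightarrow> x \<in> K"
      using t(1) unfolding B_def by blast
    then show ?thesis
      by (intro exI[of _ e]) (auto simp: algebra_simps)
  next
    case False
    then have "\<gamma> t - (l - a) \<in> interior K \<union> - K"
      using closed by (auto simp: frontier_def)
    then consider "\<gamma> t - (l - a) \<in> interior K" | "\<gamma> t - (l - a) \<in> - K"
      by blast
    then obtain e where e: "e > 0"
      "ball (\<gamma> t - (l - a)) e \<subseteq> K \<or> ball (\<gamma> t - (l - a)) e \<subseteq> - K"
      using closed by (metis interior_subset open_Compl open_contains_ball open_interior subset_trans)
    have "a + x - l \<in> ball (\<gamma> t - (l - a)) e" if "x \<in> ball (\<gamma> t) e" for x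
      using that by (simp add: dist_norm algebra_simps)
    with e show ?thesis
      by (intro exI[of _ e]) blast
  qed
  have "finite N"
    unfolding N_def by (rule fin)
  then have "\<exists>e>0. \<forall>l\<in>N. \<forall>x \<in> ball (\<gamma> t) e. \<forall>y \<in> ball (\<gamma> t) e.
               x \<notin> K \<longrightarrow> a + x - l \<in> K \<longrightarrow> a + y - l \<in> K"
    using ex
  proof (induction N rule: finite_induct)
    case empty
    then show ?case
      by (auto intro: exI[of _ 1])
  next
    case (insert l F)
    then obtain e1 where e1: "e1 > 0" "\<forall>l\<in>F. \<forall>x \<in> ball (\<gamma> t) e1. \<forall>y \<in> ball (\<gamma> t) e1.
               x \<notin> K \<longrightarrow> a + x - l \<in> K \<longrightarrow> a + y - l \<in> K"
      by auto
    obtain e2 where e2: "e2 > 0" "\<forall>x \<in> ball (\<gamma> t) e2. \<forall>y \<in> ball (\<gamma> t) e2.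
               x \<notin> K \<longrightarrow> a + x - l \<in> K \<longrightarrow> a + y - l \<in> K"
      using insert.prems by blast
    show ?case
      using e1 e2 by (intro exI[of _ "min e1 e2"]) auto
  qed
  then obtain e0 where e0: "e0 > 0" "\<And>l x y. l \<in> N \<Longrightarrow> x \<in> ball (\<gamma> t) e0 \<Longrightarrow> y \<in> ball (\<gamma> t) e0 \<Longrightarrow>
       x \<notin> K \<Longrightarrow> a + x - l \<in> K \<Longrightarrow> a + y - l \<in> K"
    by blast
  define e where "e = min e0 1"
  have e: "e > 0" "e \<le> e0" "e \<le> 1"
    using e0(1) by (auto simp: e_def)
  \<comment> \<open>Two nearby points with covering number exactly \<open>k\<close> are sampled,
    \<open>y\<close> inside \<open>K\<close> and \<open>x\<close> outside. Convexity makes the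
    interior reach the frontier point.\<close>
  have "\<gamma> t \<in> closure (interior K)"
    using frontier[OF t(1)] convex_closure_interior[OF assms(2,3)] by (simp add: frontier_def)
  then obtain w where "w \<in> interior K \<inter> ball (\<gamma> t) e"
    using e(1) by (metis IntI closure_approachable dist_commute mem_ball)
  then have "(+) a ` (interior K \<inter> ball (\<gamma> t) e) \<noteq> {}"
    by blast
  moreover have "open ((+) a ` (interior K \<inter> ball (\<gamma> t) e))"
    by (intro open_translation open_Int open_interior open_ball)
  ultimately obtain y' where y': "y' \<in> (+) a ` (interior K \<inter> ball (\<gamma> t) e)" "?S y'"
    using AE_lebesgue_meets_open[OF tile] by blast
  then obtain y where y: "y \<in> K" "y \<in> ball (\<gamma> t) e" "?S (a + y)"
    using interior_subset by blast
  have "\<gamma> t \<in> closure (- K)"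
    using frontier[OF t(1)] by (simp add: frontier_closures)
  then obtain w where "w \<in> (- K) \<inter> ball (\<gamma> t) e"
    using e(1) by (metis IntI closure_approachable dist_commute mem_ball)
  then have "(+) a ` ((- K) \<inter> ball (\<gamma> t) e) \<noteq> {}"
    by blast
  moreover have "open ((+) a ` ((- K) \<inter> ball (\<gamma> t) e))"
    using closed by (intro open_translation open_Int open_Compl open_ball)
  ultimately obtain x' where x': "x' \<in> (+) a ` ((- K) \<inter> ball (\<gamma> t) e)" "?S x'"
    using AE_lebesgue_meets_open[OF tile] by blast
  then obtain x where x: "x \<notin> K" "x \<in> ball (\<gamma> t) e" "?S (a + x)"
    by blast
  \<comment> \<open>Going from \<open>x\<close> to \<open>y\<close> loses no translate and gains
    \<open>a\<close>, so the covering number would strictly increase although it is \<open>k\<close>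
    at both points.\<close>
  have "real (m l) * indicator K (a + x - l) \<le> real (m l) * indicator K (a + y - l)"
    if "l \<in> ?L" for l
  proof (cases "a + x - l \<in> K")
    case True
    then have "l \<in> N"
      using N[of l x] that x(2) e by auto
    then have "a + y - l \<in> K"
      using e0(2)[of l x y] True x y e by auto
    then show ?thesis
      using True by (simp only: indicator_simps)
  qed simp
  moreover have "real (m a) * indicator K (a + x - a) < real (m a) * indicator K (a + y - a)"
    using a x(1) y(1) unfolding add_diff_cancel_left' by (simp only: indicator_simps) simp
  ultimately have "real k < real k"
    using a by (intro has_sum_strict_mono[OF x(3) y(3), of a]) simp_all
  then show False
    by simp
qed

section \<open>The straight and the sheared cell\<close>

text \<open>A planar section: \<open>s = 0\<close> is the capped rectangle, \<open>s = 1\<close> its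
  sheared form. Since \<open>13/4 = 3 + (1/2)^2\<close>, the right parabola meets the line
  \<open>X = 3\<close> at \<open>Y = s - 1/2\<close> and \<open>Y = s + 1/2\<close>, the ends of the
  chord of the strip there; the left one is its point reflection. As an intersection of a strip with
  two parabolic regions the set is visibly convex.\<close>

definition capped :: "real \<Rightarrow> real \<Rightarrow> real \<Rightarrow> bool" where
  "capped s X Y \<longleftrightarrow> \<bar>Y - s * X / 3\<bar> \<le> 1/2 \<and> X \<le> 13/4 - (Y - s)^2 \<and> - X \<le> 13/4 - (Y + s)^2"

definition capped_cell :: "'n \<Rightarrow> 'n \<Rightarrow> real \<Rightarrow> (real ^ 'n::finite) set" where
  "capped_cell i j s = {x. capped s (x $ i) (x $ j) \<and> (\<forall>k \<in> - {i, j}. \<bar>x $ k\<bar> \<le> 1/4)}"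

text \<open>For \<open>s = 1\<close> the cell is cut out of the one for \<open>s = 0\<close>: the point with coordinates \<open>X\<close>, \<open>Y\<close>
  moves by \<open>cell_shift X Y\<close> in direction \<open>j\<close>. The caps \<open>\<bar>X\<bar> > 3\<close> move rigidly, and where \<open>\<bar>X\<bar> \<le> 3\<close>
  the vertical chords have length 1, so the part left uncovered by the sheared strip
  reappears at its other side.\<close>

definition cell_shift :: "real \<Rightarrow> real \<Rightarrow> real" where
  "cell_shift X Y = (if X > 3 \<or> 0 \<le> X \<and> Y < X/3 - 1/2 then 1
     else if X < - 3 \<or> X \<le> 0 \<and> Y > X/3 + 1/2 then - 1 else 0)"

lemma closed_capped_cell: "closed (capped_cell i j s)"
proof -
  have "capped_cell i j s = {x. \<bar>x $ j - s * x $ i / 3\<bar> \<le> 1/2} \<inter> {x. x $ i \<le> 13/4 - (x $ j - s)^2}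
      \<inter> {x. - x $ i \<le> 13/4 - (x $ j + s)^2} \<inter> (\<Inter>k \<in> - {i, j}. {x. \<bar>x $ k\<bar> \<le> 1/4})"
    by (auto simp: capped_cell_def capped_def)
  moreover have "closed \<dots>"
    by (intro closed_Int closed_INT ballI closed_Collect_le continuous_intros) auto
  ultimately show ?thesis
    by simp
qed

lemma open_strict_capped_cell:
  fixes i j :: "'n::finite"
  shows "open {x :: real ^ 'n. \<bar>x $ j - s * x $ i / 3\<bar> < 1/2 \<and> x $ i < 13/4 - (x $ j - s)^2 \<and>
      - x $ i < 13/4 - (x $ j + s)^2 \<and> (\<forall>k \<in> - {i, j}. \<bar>x $ k\<bar> < 1/4)}" (is "open ?S")
proof -
  have "?S = {x. \<bar>x $ j - s * x $ i / 3\<bar> < 1/2} \<inter> {x. x $ i < 13/4 - (x $ j - s)^2}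
      \<inter> {x. - x $ i < 13/4 - (x $ j + s)^2} \<inter> (\<Inter>k \<in> - {i, j}. {x. \<bar>x $ k\<bar> < 1/4})"
    by auto
  moreover have "open \<dots>"
    by (intro open_Int open_INT ballI finite open_Collect_less continuous_intros) auto
  ultimately show ?thesis
    by simp
qed

lemma interior_capped_cell:
  fixes x :: "real ^ 'n::finite"
  assumes "\<bar>x $ j - s * x $ i / 3\<bar> < 1/2" "x $ i < 13/4 - (x $ j - s)^2"
      "- x $ i < 13/4 - (x $ j + s)^2" "\<And>k. k \<in> - {i, j} \<Longrightarrow> \<bar>x $ k\<bar> < 1/4"
  shows "x \<in> interior (capped_cell i j s)"
  by (rule interiorI[OF open_strict_capped_cell[of j s i]])
     (use assms in \<open>auto simp: capped_cell_def capped_def intro: less_imp_le\<close>)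

lemma zero_in_interior_capped_cell:
  assumes "0 \<le> s" "s \<le> 1"
  shows "0 \<in> interior (capped_cell i j s)"
proof -
  have "s^2 \<le> 1"
    using assms by (simp add: power_le_one)
  then show ?thesis
    by (intro interior_capped_cell) auto
qed

lemma compact_capped_cell:
  assumes "0 \<le> s" "s \<le> 1"
  shows "compact (capped_cell i j s :: (real ^ 'n::finite) set)"
proof -
  have "\<bar>x $ k\<bar> \<le> 4" if x: "x \<in> capped_cell i j s" for x :: "real ^ 'n" and k
  proof -
    have "capped s (x $ i) (x $ j)"
      using x by (simp add: capped_cell_def)
    then have "x $ i \<le> 13/4" "- x $ i \<le> 13/4" "\<bar>x $ j - s * x $ i / 3\<bar> \<le> 1/2"
      using zero_le_power2[of "x $ j - s"] zero_le_power2[of "x $ j + s"]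
      unfolding capped_def by linarith+
    moreover have "\<bar>s * x $ i\<bar> \<le> 1 * (13/4)"
      unfolding abs_mult using calculation assms by (intro mult_mono) auto
    ultimately have "\<bar>x $ i\<bar> \<le> 4" "\<bar>x $ j\<bar> \<le> 4"
      by linarith+
    moreover have "\<bar>x $ k\<bar> \<le> 4" if "k \<in> - {i, j}"
    proof -
      have "\<bar>x $ k\<bar> \<le> 1/4"
        using x that by (auto simp: capped_cell_def)
      then show ?thesis
        by simp
    qed
    ultimately show ?thesis
      by blast
  qed
  then have "capped_cell i j s \<subseteq> cbox (vec (- 4)) (vec 4)"
    by (auto simp: mem_box_cart abs_le_iff minus_le_iff)
  then show ?thesis
    using closed_capped_cell bounded_cbox bounded_subset compact_eq_bounded_closed by blast
qed

lemma convex_capped_cell: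
  fixes i j :: "'n::finite"
  shows "convex (capped_cell i j s)"
proof (rule convexI)
  fix x y :: "real ^ 'n" and u w :: real
  assume x: "x \<in> capped_cell i j s" and y: "y \<in> capped_cell i j s"
    and uw: "0 \<le> u" "0 \<le> w" "u + w = 1"
  have abs: "\<bar>u * p + w * q\<bar> \<le> c" if "\<bar>p\<bar> \<le> c" "\<bar>q\<bar> \<le> c" for p q c
    using convex_bound_le[of p c q u w] convex_bound_le[of "- p" c "- q" u w] that uw
    by (simp add: abs_le_iff)
  have sq: "(u * p + w * q)^2 \<le> u * p^2 + w * q^2" for p q :: real
    using convex_onD[OF convex_power2, of w p q] uw unfolding eq_diff_eq[THEN iffD2, OF uw(3)] by simp
  have cap: "u * X + w * X' \<le> c - (u * Y + w * Y' - d)^2"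
    if "X \<le> c - (Y - d)^2" "X' \<le> c - (Y' - d)^2" for X X' Y Y' c d
  proof -
    have "u * X + w * X' \<le> u * (c - (Y - d)^2) + w * (c - (Y' - d)^2)"
      using that uw by (intro add_mono mult_left_mono)
    also have "\<dots> = (u + w) * c - (u * (Y - d)^2 + w * (Y' - d)^2)"
      by (simp add: algebra_simps)
    also have "\<dots> \<le> c - (u * (Y - d) + w * (Y' - d))^2"
      using sq[of "Y - d" "Y' - d"] uw by simp
    also have "u * (Y - d) + w * (Y' - d) = u * Y + w * Y' - (u + w) * d"
      by (simp add: algebra_simps)
    finally show ?thesis
      using uw by simp
  qed
  have "\<bar>(u * x $ j + w * y $ j) - s * (u * x $ i + w * y $ i) / 3\<bar> \<le> 1/2"
    using abs[of "x $ j - s * x $ i / 3" "1/2" "y $ j - s * y $ i / 3"] x y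
    by (simp add: capped_cell_def capped_def algebra_simps add_divide_distrib)
  moreover have "u * x $ i + w * y $ i \<le> 13/4 - (u * x $ j + w * y $ j - s)^2"
    using x y by (intro cap) (auto simp: capped_cell_def capped_def)
  \<comment> \<open>The left cap has the form of the right one, with \<open>- X\<close> for
    \<open>X\<close> and \<open>- s\<close> for \<open>s\<close>.\<close>
  moreover have "u * (- x $ i) + w * (- y $ i) \<le> 13/4 - (u * x $ j + w * y $ j - (- s))^2"
    using x y by (intro cap) (auto simp: capped_cell_def capped_def)
  moreover have "\<bar>u * x $ k + w * y $ k\<bar> \<le> 1/4" if "k \<in> - {i, j}" for k
    using x y that by (intro abs) (auto simp: capped_cell_def)
  ultimately show "u *\<^sub>R x + w *\<^sub>R y \<in> capped_cell i j s"
    by (simp add: capped_cell_def capped_def)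
qed

text \<open>Point reflection preserves the strip and exchanges the caps. This gives central symmetry
  and later reduces the dissection to \<open>0 \<le> X\<close>.\<close>

lemma capped_uminus: "capped s (- X) (- Y) \<longleftrightarrow> capped s X Y"
proof -
  have "(- Y - s)^2 = (Y + s)^2" "(- Y + s)^2 = (Y - s)^2" "\<bar>s * X / 3 - Y\<bar> = \<bar>Y - s * X / 3\<bar>"
    by (simp_all add: power2_eq_square algebra_simps)
  then show ?thesis
    by (auto simp: capped_def)
qed

lemma uminus_capped_cell: "- x \<in> capped_cell i j s \<longleftrightarrow> x \<in> capped_cell i j s"
  by (simp add: capped_cell_def capped_uminus)

lemma centrally_symmetric_capped_cell:
  fixes i j :: "'n::finite"
  shows "centrally_symmetric (capped_cell i j s)"
  unfolding centrally_symmetric_def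
proof (intro exI[of _ 0] set_eqI iffI)
  fix x :: "real ^ 'n"
  assume "x \<in> capped_cell i j s"
  then show "x \<in> (\<lambda>x. 2 *\<^sub>R 0 - x) ` capped_cell i j s"
    by (intro image_eqI[of _ _ "- x"]) (auto simp: uminus_capped_cell)
qed (auto simp: uminus_capped_cell)

section \<open>Failure of multi-tiling for the cells\<close>

lemma finite_quadratic_roots:
  fixes a b c :: real
  assumes "a \<noteq> 0 \<or> b \<noteq> 0 \<or> c \<noteq> 0"
  shows "finite {t. a * t^2 + b * t + c = 0}"
proof -
  have "finite {t. poly [:c, b, a:] t = 0}"
    using assms by (intro poly_roots_finite) auto
  then show ?thesis
    by (simp add: algebra_simps power2_eq_square)
qed

lemma frontier_capped_cell:
  assumes "x \<in> frontier (capped_cell i j s)"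
  shows "\<bar>x $ j - s * x $ i / 3\<bar> = 1/2 \<or> x $ i = 13/4 - (x $ j - s)^2 \<or>
         - x $ i = 13/4 - (x $ j + s)^2 \<or> (\<exists>k \<in> - {i, j}. \<bar>x $ k\<bar> = 1/4)"
proof (rule ccontr)
  assume *: "\<not> ?thesis"
  have "x \<in> capped_cell i j s"
    using assms closed_capped_cell frontier_subset_closed by blast
  then have "x \<in> interior (capped_cell i j s)"
    using * by (intro interior_capped_cell) (force simp: capped_cell_def capped_def)+
  then show False
    using assms by (simp add: frontier_def)
qed

text \<open>The curve follows the right cap. A translation that fixes the plane of \<open>i\<close>
  and \<open>j\<close> is harmless near it; any other one brings the curve onto the frontier for
  only finitely many parameters.\<close>

lemma not_multi_tiler_capped_cell:
  fixes i j :: "'n::finite"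
  assumes s: "0 \<le> s" "s \<le> 1" and ij: "i \<noteq> j"
  shows "\<not> multi_tiler (capped_cell i j s)"
proof -
  \<comment> \<open>In the plane this runs along the right parabola with tip at
    \<open>t = 0\<close>. The remaining coordinates equal \<open>t\<close>, so that the curve is
    transversal to the faces of the cube and lies in no face of a translate.\<close>
  define \<gamma> :: "real \<Rightarrow> real ^ 'n"
    where "\<gamma> t = (\<chi> k. if k = i then 13/4 - t^2 else if k = j then s + t else t)" for t
  have \<gamma>: "\<gamma> t $ i = 13/4 - t^2" "\<gamma> t $ j = s + t" "\<And>k. k \<in> - {i, j} \<Longrightarrow> \<gamma> t $ k = t" for t
    using ij by (auto simp: \<gamma>_def)
  \<comment> \<open>For these \<open>t\<close> the curve satisfies the strip condition and stays
    strictly inside the cube.\<close>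
  let ?U = "{-1/4 <..< 1/4 :: real}" and ?K = "capped_cell i j s"
  have front: "\<gamma> t \<in> frontier ?K" if t: "t \<in> ?U" for t
  proof -
    have t2: "0 \<le> t^2" "t^2 \<le> (1/4)^2"
      using t abs_le_square_iff[of t "1/4"] by auto
    have "0 \<le> s * t^2" "s * t^2 \<le> 1 * (1/4)^2"
      using s t2 by (simp, intro mult_mono) auto
    moreover have "s + t - s * (13/4 - t^2) / 3 = t - s / 12 + s * t^2 / 3"
      by (simp add: field_simps)
    moreover have "- 1/4 < t" "t < 1/4"
      using t by auto
    ultimately have "\<bar>s + t - s * (13/4 - t^2) / 3\<bar> \<le> 1/2"
      using s by (simp only: abs_le_iff power2_eq_square) linarith
    moreover have "(s + t + s)^2 \<le> (9/4)^2"
      using s t by (intro abs_le_square_iff[THEN iffD1]) (auto simp: abs_if)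
    moreover have "\<bar>t\<bar> \<le> 1/4"
      using t by (auto simp: abs_if)
    ultimately have "\<gamma> t \<in> ?K"
      using t2 by (simp add: capped_cell_def capped_def \<gamma> power2_eq_square)
    moreover have "\<gamma> t \<notin> interior ?K"
    proof
      assume "\<gamma> t \<in> interior ?K"
      then obtain e where e: "e > 0" "ball (\<gamma> t) e \<subseteq> ?K"
        by (auto simp: mem_interior)
      have "\<gamma> t + (e/2) *\<^sub>R axis i 1 \<in> ball (\<gamma> t) e"
        using e(1) by (simp add: dist_norm)
      then have "\<gamma> t + (e/2) *\<^sub>R axis i 1 \<in> ?K"
        using e(2) by blast
      then show False
        using e(1) ij by (simp add: capped_cell_def capped_def \<gamma> axis_def)
    qed
    ultimately show ?thesis
      using closure_subset by (auto simp: frontier_def)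
  qed
  have "countable {t \<in> ?U. \<gamma> t - v \<in> frontier ?K \<and>
                    \<not> (\<exists>e>0. \<forall>x \<in> ball (\<gamma> t) e. x - v \<in> ?K \<longrightarrow> x \<in> ?K)}" (is "countable ?B") for v
  proof (cases "v $ i = 0 \<and> v $ j = 0")
    case True
    \<comment> \<open>Here \<open>x\<close> and \<open>x - v\<close> have the same planar section,
      and the radius is the distance from \<open>t\<close> to the ends of the cube, so
      \<open>x\<close> satisfies the cube conditions too.\<close>
    have "\<exists>e>0. \<forall>x \<in> ball (\<gamma> t) e. x - v \<in> ?K \<longrightarrow> x \<in> ?K" if t: "t \<in> ?U" for t
    proof (intro exI[of _ "1/4 - \<bar>t\<bar>"] conjI ballI impI)
      show "0 < 1/4 - \<bar>t\<bar>"
        using t by auto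
    next
      fix x assume x: "x \<in> ball (\<gamma> t) (1/4 - \<bar>t\<bar>)" "x - v \<in> ?K"
      have "\<bar>x $ k\<bar> \<le> 1/4" if "k \<in> - {i, j}" for k
      proof -
        have "\<bar>(\<gamma> t - x) $ k\<bar> < 1/4 - \<bar>t\<bar>"
          using x(1) component_le_norm_cart[of "\<gamma> t - x" k] by (simp add: dist_norm)
        then show ?thesis
          using \<gamma>(3)[OF that, of t] by simp
      qed
      then show "x \<in> ?K"
        using x(2) True by (simp add: capped_cell_def)
    qed
    then have "?B = {}"
      by blast
    then show ?thesis
      by (simp only: countable_empty)
  next
    case False
    let ?a = "v $ i" and ?b = "v $ j"
    let ?c = "s - ?b - s * (13/4 - ?a) / 3"
    \<comment> \<open>In order: the two edges of the strip, the right cap, the left cap, the faces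
      of the cube. The strip equations have linear coefficient 1, the left cap has leading
      coefficient 2, and the right cap equation is trivial only for
      \<open>?a = ?b = 0\<close>.\<close>
    have "?B \<subseteq> {t. s/3 * t^2 + 1 * t + (?c - 1/2) = 0} \<union> {t. s/3 * t^2 + 1 * t + (?c + 1/2) = 0}
       \<union> {t. 0 * t^2 + (- 2 * ?b) * t + (?b^2 - ?a) = 0}
       \<union> {t. 2 * t^2 + 2 * (2 * s - ?b) * t + ((2 * s - ?b)^2 + ?a - 13/2) = 0}
       \<union> (\<Union>k \<in> - {i, j}. {v $ k + 1/4, v $ k - 1/4})" (is "_ \<subseteq> ?R")
    proof
      fix t assume "t \<in> ?B"
      then have "\<gamma> t - v \<in> frontier ?K"
        by simp
      from frontier_capped_cell[OF this] consider
          "\<bar>s + t - ?b - s * (13/4 - t^2 - ?a) / 3\<bar> = 1/2"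
        | "13/4 - t^2 - ?a = 13/4 - (s + t - ?b - s)^2"
        | "- (13/4 - t^2 - ?a) = 13/4 - (s + t - ?b + s)^2"
        | k where "k \<in> - {i, j}" "\<bar>t - v $ k\<bar> = 1/4"
        using \<gamma> by (auto simp del: Compl_iff)
      then show "t \<in> ?R"
      proof cases
        case 1
        then have "s + t - ?b - s * (13/4 - t^2 - ?a) / 3 = 1/2
                 \<or> s + t - ?b - s * (13/4 - t^2 - ?a) / 3 = - 1/2"
          by linarith
        then have "s/3 * t^2 + 1 * t + (?c - 1/2) = 0 \<or> s/3 * t^2 + 1 * t + (?c + 1/2) = 0"
          by (simp add: algebra_simps) argo
        then show ?thesis
          by blast
      next
        case 2
        then have "0 * t^2 + (- 2 * ?b) * t + (?b^2 - ?a) = 0"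
          by (simp add: power2_eq_square algebra_simps)
        then show ?thesis
          by blast
      next
        case 3
        then have "2 * t^2 + 2 * (2 * s - ?b) * t + ((2 * s - ?b)^2 + ?a - 13/2) = 0"
          by (simp add: power2_eq_square algebra_simps)
        then show ?thesis
          by blast
      next
        case (4 k)
        then have "t = v $ k + 1/4 \<or> t = v $ k - 1/4"
          by linarith
        then show ?thesis
          using 4(1) by blast
      qed
    qed
    moreover have "finite ?R"
      using False by (intro finite_UnI finite_UN_I finite_quadratic_roots) auto
    ultimately show ?thesis
      using countable_finite finite_subset by blast
  qed
  then show ?thesis
    using zero_in_interior_capped_cell[OF s]
    by (intro not_multi_tiler_if_unshared_frontier[of _ ?U \<gamma>] compact_capped_cell convex_capped_cell front s)
       (auto simp: uncountable_open_interval)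
qed

section \<open>Fourier coefficients and integer translations\<close>

lemma set_integrable_character:
  fixes A :: "'a::euclidean_space set"
  assumes "A \<in> sets borel" "bounded A"
  shows "set_integrable lebesgue A (\<lambda>x. exp (- 2 * complex_of_real pi * \<i> * complex_of_real (x \<bullet> \<xi>)))"
proof -
  have "(\<lambda>x. exp (- 2 * complex_of_real pi * \<i> * complex_of_real (x \<bullet> \<xi>))) \<in> borel_measurable borel"
    by measurable
  then have "integrable lborel
      (\<lambda>x. indicator A x *\<^sub>R exp (- 2 * complex_of_real pi * \<i> * complex_of_real (x \<bullet> \<xi>)))"
    using assms emeasure_bounded_finite[OF assms(2)]
    by (intro integrableI_bounded_set_indicator[where B = 1]) auto
  then show ?thesis
    unfolding set_integrable_def by (subst integrable_completion) (use assms in auto)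
qed

lemma integral_lebesgue_translation:
  fixes f :: "'a::euclidean_space \<Rightarrow> 'b::{banach, second_countable_topology}"
  assumes [measurable]: "f \<in> borel_measurable borel"
  shows "(LINT x|lebesgue. f (x - v)) = (LINT x|lebesgue. f x)"
proof -
  have "(LINT x|lebesgue. f (x - v)) = (LINT x|lborel. f (x - v))"
    by (rule integral_completion) measurable
  also have "\<dots> = (LINT x|distr lborel borel ((+) v). f (x - v))"
    by (simp add: lborel_distr_plus)
  also have "\<dots> = (LINT x|lborel. f x)"
    by (subst integral_distr) auto
  also have "\<dots> = (LINT x|lebesgue. f x)"
    by (rule integral_completion[symmetric]) simp
  finally show ?thesis .
qed

lemma inner_integer_points:
  assumes "v \<in> integer_points" "n \<in> integer_points"
  shows "v \<bullet> n \<in> \<int>"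
  using assms by (auto simp: inner_vec_def integer_points_def intro!: Ints_sum Ints_mult)

lemma exp_character_integer_translation:
  assumes "v \<in> integer_points" "n \<in> integer_points"
  shows "exp (- 2 * complex_of_real pi * \<i> * complex_of_real ((x - v) \<bullet> n)) =
         exp (- 2 * complex_of_real pi * \<i> * complex_of_real (x \<bullet> n))"
proof -
  obtain z :: int where z: "v \<bullet> n = of_int z"
    using inner_integer_points[OF assms] by (auto elim: Ints_cases)
  have "- 2 * complex_of_real pi * \<i> * complex_of_real ((x - v) \<bullet> n) =
        - 2 * complex_of_real pi * \<i> * complex_of_real (x \<bullet> n) + \<i> * (of_int z * (of_real pi * 2))"
    by (simp add: inner_diff_left z algebra_simps)
  then show ?thesis
    by (simp only: exp_plus_2pin)
qed

text \<open>The character at an integer point does not notice an integer shift of a piece. The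
  identity of indicators expresses disjointness and covering at once, up to a null set.\<close>

lemma fourier_indicator_translated_pieces:
  fixes Q :: "(real ^ 'n::finite) set"
  assumes "finite I" and n: "n \<in> integer_points"
    and A: "\<And>c. c \<in> I \<Longrightarrow> A c \<in> sets borel" "\<And>c. c \<in> I \<Longrightarrow> bounded (A c)"
      "\<And>c. c \<in> I \<Longrightarrow> v c \<in> integer_points"
    and Q: "Q \<in> sets borel"
    and pieces: "AE x in lebesgue. indicator Q x = (\<Sum>c\<in>I. indicator (A c) (x - v c) :: real)"
  shows "fourier_indicator Q n = (\<Sum>c\<in>I. fourier_indicator (A c) n)"
proof -
  let ?e = "\<lambda>x. exp (- 2 * complex_of_real pi * \<i> * complex_of_real (x \<bullet> n))"
  have e [measurable]: "?e \<in> borel_measurable borel"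
    by measurable
  have tr: "indicator (A c) (x - v c) *\<^sub>R ?e (x - v c) = indicator (A c) (x - v c) *\<^sub>R ?e x"
    if "c \<in> I" for c x
    using exp_character_integer_translation[OF A(3)[OF that] n] by simp
  have meas: "(\<lambda>x. indicator (A c) x *\<^sub>R ?e x) \<in> borel_measurable borel" if "c \<in> I" for c
    using A(1)[OF that] by measurable
  have meas': "(\<lambda>x. indicator (A c) (x - v c) *\<^sub>R ?e x) \<in> borel_measurable borel" if "c \<in> I" for c
  proof -
    have "(\<lambda>x. indicator (A c) (x - v c) *\<^sub>R ?e (x - v c)) \<in> borel_measurable borel"
      using A(1)[OF that] by measurable
    then show ?thesis
      by (simp only: tr[OF that])
  qed
  have int: "integrable lebesgue (\<lambda>x. indicator (A c) (x - v c) *\<^sub>R ?e x)" if "c \<in> I" for c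
  proof -
    have "{x. x - v c \<in> A c} = (+) (v c) ` A c"
      by (force simp: image_iff algebra_simps)
    then have "bounded {x. x - v c \<in> A c}"
      using A(2)[OF that] by (simp add: bounded_translation)
    moreover have "{x. x - v c \<in> A c} \<in> sets borel"
    proof -
      have "(\<lambda>x. x - v c) -` A c \<inter> space borel \<in> sets borel"
        using A(1)[OF that] by (intro measurable_sets[of _ borel borel]) auto
      then show ?thesis
        by (simp add: vimage_def)
    qed
    ultimately have "set_integrable lebesgue {x. x - v c \<in> A c} ?e"
      by (intro set_integrable_character)
    then show ?thesis
      by (simp add: set_integrable_def indicator_def)
  qed
  have lift: "f \<in> borel_measurable lebesgue" if "f \<in> borel_measurable borel" for f :: "real ^ 'n \<Rightarrow> complex"
    using that by (simp add: measurable_completion)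
  have "fourier_indicator Q n = (LINT x|lebesgue. (\<Sum>c\<in>I. indicator (A c) (x - v c) *\<^sub>R ?e x))"
    unfolding fourier_indicator_def set_lebesgue_integral_def
  proof (rule integral_cong_AE)
    show "(\<lambda>x. indicator Q x *\<^sub>R ?e x) \<in> borel_measurable lebesgue"
      using Q by (intro lift borel_measurable_scaleR borel_measurable_indicator e)
    show "(\<lambda>x. \<Sum>c\<in>I. indicator (A c) (x - v c) *\<^sub>R ?e x) \<in> borel_measurable lebesgue"
      using meas' by (intro borel_measurable_sum lift)
    show "AE x in lebesgue. indicator Q x *\<^sub>R ?e x = (\<Sum>c\<in>I. indicator (A c) (x - v c) *\<^sub>R ?e x)"
      using pieces by eventually_elim (simp add: scaleR_sum_left)
  qed
  also have "\<dots> = (\<Sum>c\<in>I. LINT x|lebesgue. indicator (A c) (x - v c) *\<^sub>R ?e x)"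
    using int by (rule Bochner_Integration.integral_sum)
  \<comment> \<open>Periodicity turns the integrand into a function of \<open>x - v c\<close>, ready
    for translation invariance.\<close>
  also have "\<dots> = (\<Sum>c\<in>I. LINT x|lebesgue. indicator (A c) (x - v c) *\<^sub>R ?e (x - v c))"
    by (intro sum.cong refl) (simp only: tr)
  also have "\<dots> = (\<Sum>c\<in>I. fourier_indicator (A c) n)"
    unfolding fourier_indicator_def set_lebesgue_integral_def
    by (intro sum.cong refl integral_lebesgue_translation meas)
  finally show ?thesis .
qed

section \<open>Cutting the cell into integer translates\<close>

lemma square_le_quarter_iff: "u^2 \<le> 1/4 \<longleftrightarrow> \<bar>u\<bar> \<le> 1/2" for u :: real
  using abs_le_square_iff[of u "1/2"] by (simp add: power2_eq_square)

text \<open>Beyond \<open>X = 3\<close> the right parabola alone implies the other constraints in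
  both cells, so the caps differ by a unit shift in \<open>Y\<close>.\<close>

lemma capped_1_iff_cap:
  assumes "X > 3"
  shows "capped 1 X Y \<longleftrightarrow> capped 0 X (Y - 1)"
proof (cases "X \<le> 13/4 - (Y - 1)^2")
  case True
  define u where "u = Y - 1"
  have u: "X \<le> 13/4 - u^2" "u^2 \<le> 1/4"
    using True assms by (auto simp: u_def)
  then have "\<bar>u\<bar> \<le> 1/2"
    using square_le_quarter_iff by blast
  \<comment> \<open>This is the factored form of the fact that the parabola lies above the lower
    edge of the sheared strip: the cap is flat enough for the slope \<open>1/3\<close>.\<close>
  then have "0 \<le> (u + 1/2) * (u + 5/2)"
    by (intro mult_nonneg_nonneg) auto
  then have "0 \<le> u^2 + 3 * u + 5/4"
    by (simp add: field_simps power2_eq_square)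
  then have "\<bar>u + 1 - X/3\<bar> \<le> 1/2"
    using u assms \<open>\<bar>u\<bar> \<le> 1/2\<close> by linarith
  moreover have "(u + 2)^2 = u^2 + 4 * u + 4"
    by (simp add: algebra_simps power2_eq_square)
  then have "- X \<le> 13/4 - (u + 2)^2"
    using u assms \<open>\<bar>u\<bar> \<le> 1/2\<close> by linarith
  moreover have "Y = u + 1"
    by (simp add: u_def)
  moreover have "- X \<le> 13/4 - u^2"
    using u assms by linarith
  ultimately show ?thesis
    using \<open>\<bar>u\<bar> \<le> 1/2\<close> u by (simp add: capped_def add.assoc)
qed (auto simp: capped_def)

text \<open>Before the caps begin, the strip implies both parabolic constraints.\<close>

lemma capped_1_iff_strip:
  assumes "0 \<le> X" "X \<le> 3"
  shows "capped 1 X Y \<longleftrightarrow> \<bar>Y - X/3\<bar> \<le> 1/2"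
proof (cases "\<bar>Y - X/3\<bar> \<le> 1/2")
  case True
  \<comment> \<open>\<open>u\<close> is the height over the axis of the strip; \<open>w\<close> and
    \<open>2 - w\<close> are a third of the distances to \<open>X = 3\<close> and
    \<open>X = - 3\<close>. The parabolic constraints then follow from products of nonnegative
    factors.\<close>
  define u w where "u = Y - X/3" and "w = 1 - X/3"
  have u: "u^2 \<le> 1/4" "\<bar>u\<bar> \<le> 1/2" and w: "0 \<le> w" "w \<le> 1"
    using True assms unfolding square_le_quarter_iff by (auto simp: u_def w_def)
  have "0 \<le> w * (1 + 2 * u)" "0 \<le> (1 - w) * w" "0 \<le> (2 - w) * (1 - 2 * u)"
    using u w by auto
  then have "(u - w)^2 \<le> 1/4 + 3 * w" "(u + (2 - w))^2 \<le> 1/4 + 3 * (2 - w)"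
    using u w by (simp_all add: algebra_simps power2_eq_square)
  moreover have "u - w = Y - 1" "u + (2 - w) = Y + 1" "X = 3 - 3 * w"
    by (simp_all add: u_def w_def)
  ultimately have "X \<le> 13/4 - (Y - 1)^2" "- X \<le> 13/4 - (Y + 1)^2"
    by auto
  then show ?thesis
    by (simp add: capped_def)
qed (auto simp: capped_def)

lemma capped_0_iff_strip:
  assumes "\<bar>X\<bar> \<le> 3"
  shows "capped 0 X Y \<longleftrightarrow> \<bar>Y\<bar> \<le> 1/2"
proof -
  have "X \<le> 13/4 - Y^2 \<and> - X \<le> 13/4 - Y^2" if "\<bar>Y\<bar> \<le> 1/2"
    using that assms unfolding square_le_quarter_iff[symmetric] by linarith
  then show ?thesis
    by (auto simp: capped_def)
qed

lemma capped_translated_pieces_nonneg: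
  assumes "Y \<noteq> 1/2" "Y - X/3 \<noteq> 1/2" "0 \<le> X"
  shows "of_bool (capped 1 X Y) =
    (\<Sum>c\<in>{-1, 0, 1}. of_bool (capped 0 X (Y - c) \<and> cell_shift X (Y - c) = c) :: real)"
proof (cases "X > 3")
  case True
  then show ?thesis
    using capped_1_iff_cap[OF True] by (simp add: cell_shift_def)
next
  case False
  then have "\<bar>X\<bar> \<le> 3" "X \<le> 3"
    using assms by auto
  note strips = capped_0_iff_strip[OF \<open>\<bar>X\<bar> \<le> 3\<close>] capped_1_iff_strip[OF assms(3) \<open>X \<le> 3\<close>]
  have "\<not> (capped 0 X (Y + 1) \<and> cell_shift X (Y + 1) = - 1)"
    using assms \<open>X \<le> 3\<close> unfolding strips by (auto simp: cell_shift_def abs_le_iff)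
  moreover have "capped 0 X Y \<and> cell_shift X Y = 0 \<longleftrightarrow> \<bar>Y\<bar> \<le> 1/2 \<and> X/3 - 1/2 \<le> Y"
    using assms \<open>X \<le> 3\<close> unfolding strips by (auto simp: cell_shift_def abs_le_iff)
  moreover have "capped 0 X (Y - 1) \<and> cell_shift X (Y - 1) = 1 \<longleftrightarrow> \<bar>Y - 1\<bar> \<le> 1/2 \<and> Y - 1 < X/3 - 1/2"
    using assms \<open>X \<le> 3\<close> unfolding strips by (auto simp: cell_shift_def abs_le_iff)
  \<comment> \<open>The chord of the sheared strip is split at height \<open>1/2\<close>: below it
    lies the unmoved piece, above it the piece raised by 1.\<close>
  moreover have "capped 1 X Y \<longleftrightarrow>
      \<bar>Y\<bar> \<le> 1/2 \<and> X/3 - 1/2 \<le> Y \<or> \<bar>Y - 1\<bar> \<le> 1/2 \<and> Y - 1 < X/3 - 1/2"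
    using assms \<open>X \<le> 3\<close> unfolding strips abs_le_iff by linarith
  moreover have "\<not> (\<bar>Y\<bar> \<le> 1/2 \<and> \<bar>Y - 1\<bar> \<le> 1/2)"
    using assms by auto
  moreover have "(\<Sum>c\<in>{-1, 0, 1}. f c) = f (- 1) + f 0 + f 1" for f :: "real \<Rightarrow> real"
    by simp
  ultimately show ?thesis
    by (simp only: diff_minus_eq_add diff_zero) auto
qed

text \<open>The excluded values are the edges of the two strips, where pieces may overlap or miss a
  point. Negative \<open>X\<close> follows by reflection, which exchanges the pieces for
  \<open>c\<close> and \<open>- c\<close>.\<close>

lemma capped_translated_pieces:
  assumes "Y \<noteq> 1/2" "Y \<noteq> - 1/2" "Y - X/3 \<noteq> 1/2" "Y - X/3 \<noteq> - 1/2"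
  shows "of_bool (capped 1 X Y) =
    (\<Sum>c\<in>{-1, 0, 1}. of_bool (capped 0 X (Y - c) \<and> cell_shift X (Y - c) = c) :: real)"
proof (cases "0 \<le> X")
  case False
  have shift: "cell_shift (- X) (- Z) = - cell_shift X Z" for Z
    using False by (auto simp: cell_shift_def)
  have "of_bool (capped 1 (- X) (- Y)) =
    (\<Sum>c\<in>{-1, 0, 1}. of_bool (capped 0 (- X) (- Y - c) \<and> cell_shift (- X) (- Y - c) = c) :: real)"
    using assms False by (intro capped_translated_pieces_nonneg) auto
  moreover have minus: "- Y - c = - (Y - - c)" for c
    by simp
  ultimately show ?thesis
    unfolding minus capped_uminus shift by (auto simp: of_bool_def simp del: sum_of_bool_eq)
qed (use assms capped_translated_pieces_nonneg in blast)

lemma AE_capped_cell_pieces: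
  fixes i j :: "'n::finite"
  assumes ij: "i \<noteq> j"
  shows "AE x in lebesgue. indicator (capped_cell i j 1) x =
     (\<Sum>c\<in>{-1, 0, 1}. indicator {x \<in> capped_cell i j 0. cell_shift (x $ i) (x $ j) = c} (x - axis j c) :: real)"
proof -
  define H :: "real \<Rightarrow> real \<Rightarrow> (real ^ 'n) set" where "H a b = {x. (axis j 1 - axis i a) \<bullet> x = b}" for a b
  have H: "x \<in> H a b \<longleftrightarrow> x $ j - a * x $ i = b" for x a b
    by (simp add: H_def inner_diff_left inner_axis')
  have "H a b \<in> null_sets lebesgue" for a b
  proof -
    have "(axis j 1 - axis i a :: real ^ 'n) $ j \<noteq> 0"
      using ij by (simp add: axis_def)
    then have "axis j 1 - axis i a \<noteq> (0 :: real ^ 'n)"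
      by force
    then show ?thesis
      unfolding H_def by (simp add: negligible_hyperplane flip: negligible_iff_null_sets)
  qed
  then have "AE x in lebesgue. x \<notin> H a b" for a b
    by (rule AE_not_in)
  \<comment> \<open>Slope \<open>0\<close> gives the edges of the straight strip, slope
    \<open>1/3\<close> those of the sheared one.\<close>
  note this[of 0 "1/2"] this[of 0 "- 1/2"] this[of "1/3" "1/2"] this[of "1/3" "- 1/2"]
  then show ?thesis
  proof eventually_elim
    case (elim x)
    let ?W = "\<forall>k \<in> - {i, j}. \<bar>x $ k\<bar> \<le> 1/4"
    have co: "(x - axis j c) $ i = x $ i" "(x - axis j c) $ j = x $ j - c"
       "k \<in> - {i, j} \<Longrightarrow> (x - axis j c) $ k = x $ k" for c k
      using ij by (auto simp: axis_def)
    have "indicator {x \<in> capped_cell i j 0. cell_shift (x $ i) (x $ j) = c} (x - axis j c) =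
        of_bool ?W * (of_bool (capped 0 (x $ i) (x $ j - c) \<and> cell_shift (x $ i) (x $ j - c) = c) :: real)" for c
      by (simp add: indicator_def capped_cell_def co del: vector_minus_component Compl_iff)
    moreover have "indicator (capped_cell i j 1) x = of_bool ?W * (of_bool (capped 1 (x $ i) (x $ j)) :: real)"
      by (auto simp: indicator_def capped_cell_def)
    moreover have "of_bool (capped 1 (x $ i) (x $ j)) =
       (\<Sum>c\<in>{-1, 0, 1}. of_bool (capped 0 (x $ i) (x $ j - c) \<and> cell_shift (x $ i) (x $ j - c) = c) :: real)"
      using elim by (intro capped_translated_pieces) (auto simp: H)
    ultimately show ?case
      by (simp only: sum_distrib_left)
  qed
qed

text \<open>Both cells are assembled from the same pieces \<open>A c\<close>, one with zero shifts
  and the other with shifts \<open>axis j c\<close>, so both coefficients equal the same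
  sum.\<close>

lemma fourier_indicator_capped_cell:
  fixes i j :: "'n::finite"
  assumes ij: "i \<noteq> j" and n: "n \<in> integer_points"
  shows "fourier_indicator (capped_cell i j 0) n = fourier_indicator (capped_cell i j 1) n"
proof -
  define A where "A c = {x \<in> capped_cell i j 0. cell_shift (x $ i) (x $ j) = c}" for c
  have borel: "capped_cell i j s \<in> sets borel" for s
    using closed_capped_cell by (rule borel_closed)
  have A: "A c \<in> sets borel" "bounded (A c)" for c
  proof -
    have [measurable]: "(\<lambda>x :: real ^ 'n. x $ k) \<in> borel_measurable borel" for k
      by (intro borel_measurable_continuous_onI continuous_intros)
    have "{x :: real ^ 'n. cell_shift (x $ i) (x $ j) = c} \<in> sets borel"
      unfolding cell_shift_def by measurable
    then have "capped_cell i j 0 \<inter> {x. cell_shift (x $ i) (x $ j) = c} \<in> sets borel"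
      using borel by (rule sets.Int[rotated])
    then show "A c \<in> sets borel"
      by (simp add: A_def Int_def)
    show "bounded (A c)"
      using compact_imp_bounded[OF compact_capped_cell[of 0]] by (rule bounded_subset) (auto simp: A_def)
  qed
  have shifts: "axis j c \<in> integer_points" "0 \<in> integer_points" if "c \<in> {-1, 0, 1}" for c :: real
    using that by (auto simp: integer_points_def axis_def)
  have "indicator (capped_cell i j 0) x = (\<Sum>c\<in>{-1, 0, 1}. indicator (A c) (x - 0) :: real)" for x
    by (auto simp: indicator_def A_def cell_shift_def)
  then have AE: "AE x in lebesgue. indicator (capped_cell i j 0) x =
      (\<Sum>c\<in>{-1, 0, 1}. indicator (A c) (x - 0) :: real)"
    by (intro AE_I2)
  have "fourier_indicator (capped_cell i j 0) n = (\<Sum>c\<in>{-1, 0, 1}. fourier_indicator (A c) n)"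
    by (rule fourier_indicator_translated_pieces[OF _ n A shifts(2) borel AE]) simp
  also have "\<dots> = fourier_indicator (capped_cell i j 1) n"
    by (rule fourier_indicator_translated_pieces[OF _ n A shifts(1) borel
          AE_capped_cell_pieces[OF ij, folded A_def], symmetric]) simp_all
  finally show ?thesis .
qed

section \<open>Excluding congruence\<close>

text \<open>Equality up to a null set becomes a pointwise inclusion: the interior of
  \<open>Q\<close> minus a closed set is open and null, hence empty, and \<open>Q\<close> lies in
  the closure of its interior.\<close>

lemma rigid_motion_superset_of_convex_body:
  fixes P Q :: "'a::euclidean_space set"
  assumes T: "rigid_motion T" "sym_diff (T ` P) Q \<in> null_sets lebesgue"
    and "compact P" "convex Q" "interior Q \<noteq> {}"
  shows "Q \<subseteq> T ` P"
proof -
  have "continuous_on P T"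
    using T(1) by (auto simp: rigid_motion_def continuous_on_iff)
  then have closed: "closed (T ` P)"
    using assms(3) by (intro compact_imp_closed compact_continuous_image)
  have "negligible (sym_diff (T ` P) Q)"
    using T(2) by (simp add: negligible_iff_null_sets)
  then have "negligible (interior Q - T ` P)"
    by (rule negligible_subset) (use interior_subset in blast)
  moreover have "open (interior Q - T ` P)"
    using closed by (intro open_Diff open_interior)
  ultimately have "interior Q \<subseteq> T ` P"
    using open_not_negligible by blast
  then have "closure (interior Q) \<subseteq> T ` P"
    using closed by (rule closure_minimal)
  then show ?thesis
    using convex_closure_interior[OF assms(4,5)] closure_subset by blast
qed

lemma capped_cells_not_congruent:
  fixes i j :: "'n::finite"
  assumes ij: "i \<noteq> j" and T: "rigid_motion T"
  shows "sym_diff (T ` capped_cell i j 0) (capped_cell i j 1) \<notin> null_sets lebesgue"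
proof
  assume "sym_diff (T ` capped_cell i j 0) (capped_cell i j 1) \<in> null_sets lebesgue"
  then have sub: "capped_cell i j 1 \<subseteq> T ` capped_cell i j 0"
    using zero_in_interior_capped_cell[of 1 i j]
    by (intro rigid_motion_superset_of_convex_body[OF T] compact_capped_cell convex_capped_cell) auto
  \<comment> \<open>A tip of the right cap of the sheared cell, placed over a corner of the cube. It
    dominates every point of the straight cell coordinatewise in absolute value, strictly in
    coordinate \<open>j\<close>.\<close>
  define q :: "real ^ 'n" where "q = (\<chi> k. if k = i then 13/4 else if k = j then 1 else 1/4)"
  have "q \<in> capped_cell i j 1"
    using ij by (auto simp: q_def capped_cell_def capped_def power2_eq_square)
  then have "q \<in> T ` capped_cell i j 0" "- q \<in> T ` capped_cell i j 0"
    using sub uminus_capped_cell by blast+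
  then obtain x y where xy: "x \<in> capped_cell i j 0" "y \<in> capped_cell i j 0" "q = T x" "- q = T y"
    by blast
  have power2_le_if_abs_le: "a^2 \<le> b^2" if "\<bar>a\<bar> \<le> b" for a b :: real
    using that by (intro abs_le_square_iff[THEN iffD1]) auto
  have power2_less_if_abs_less: "a^2 < b^2" if "\<bar>a\<bar> < b" for a b :: real
    using that power_strict_mono[of "\<bar>a\<bar>" b 2] by simp
  have small: "norm x < norm q" if x: "x \<in> capped_cell i j 0" for x
  proof -
    have "capped 0 (x $ i) (x $ j)"
      using x by (simp add: capped_cell_def)
    then have X: "\<bar>x $ i\<bar> \<le> 13/4" "\<bar>x $ j\<bar> \<le> 1/2"
      using zero_le_power2[of "x $ j - 0"] zero_le_power2[of "x $ j + 0"]
      unfolding capped_def abs_le_iff by linarith+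
    have "\<bar>x $ k\<bar> \<le> q $ k" for k
      using x X by (auto simp: q_def capped_cell_def)
    moreover have "\<bar>x $ j\<bar> < q $ j"
      using X ij by (simp add: q_def)
    ultimately have "(\<Sum>k\<in>UNIV. (x $ k)^2) < (\<Sum>k\<in>UNIV. (q $ k)^2)"
      by (intro sum_strict_mono_ex1 ballI bexI[of _ j])
         (auto intro!: power2_le_if_abs_le power2_less_if_abs_less)
    then show ?thesis
      by (simp add: norm_vec_def L2_set_def)
  qed
  \<comment> \<open>The preimages of \<open>q\<close> and \<open>- q\<close> would be two points of
    the straight cell at distance \<open>2 * norm q\<close>, but both have norm below
    \<open>norm q\<close>.\<close>
  have "2 * norm q = dist q (- q)"
    by (simp add: dist_norm norm_mult_numeral2 flip: scaleR_2)
  also have "\<dots> = dist x y"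
    using T xy by (simp add: rigid_motion_def)
  also have "\<dots> \<le> norm x + norm y"
    by (simp add: dist_norm norm_triangle_ineq4)
  finally show False
    using small[OF xy(1)] small[OF xy(2)] by simp
qed

section \<open>Assembling both dimensions\<close>

lemma body_capped_cell:
  assumes "0 \<le> s" "s \<le> 1"
  shows "body (capped_cell i j s)"
  using zero_in_interior_capped_cell[OF assms] compact_capped_cell[OF assms]
  unfolding body_def by blast

lemma emeasure_body_pos:
  assumes "body K"
  shows "emeasure lebesgue K > 0"
proof -
  have "\<not> negligible K"
    using assms open_not_negligible[OF open_interior] interior_subset negligible_subset
    unfolding body_def by blast
  moreover have "K \<in> sets lebesgue"
    using assms by (intro fmeasurableD lmeasurable_compact) (simp add: body_def)
  ultimately show ?thesis
    by (simp add: negligible_iff_null_sets null_sets_def zero_less_iff_neq_zero)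
qed

text \<open>Dimension enters only through two distinct coordinate indices; for an index type with
  two elements the cube factor disappears.\<close>

lemma exists_equal_integer_spectrum:
  fixes i j :: "'n::finite"
  assumes ij: "i \<noteq> j"
  shows "\<exists>P Q :: (real ^ 'n) set.
           convex P \<and> centrally_symmetric P \<and> body P \<and> emeasure lebesgue P > 0 \<and> \<not> multi_tiler P \<and>
           convex Q \<and> centrally_symmetric Q \<and> body Q \<and> emeasure lebesgue Q > 0 \<and> \<not> multi_tiler Q \<and>
           (\<forall>n \<in> integer_points. fourier_indicator P n = fourier_indicator Q n) \<and>
           \<not> (\<exists>T. rigid_motion T \<and> sym_diff (T ` P) Q \<in> null_sets lebesgue)"
proof (intro exI conjI)
  show "convex (capped_cell i j 0)" "convex (capped_cell i j 1)"
    by (rule convex_capped_cell)+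
  show "centrally_symmetric (capped_cell i j 0)" "centrally_symmetric (capped_cell i j 1)"
    by (rule centrally_symmetric_capped_cell)+
  show body: "body (capped_cell i j 0)" "body (capped_cell i j 1)"
    by (simp_all add: body_capped_cell)
  show "emeasure lebesgue (capped_cell i j 0) > 0" "emeasure lebesgue (capped_cell i j 1) > 0"
    using body by (auto intro: emeasure_body_pos)
  show "\<not> multi_tiler (capped_cell i j 0)" "\<not> multi_tiler (capped_cell i j 1)"
    using ij by (simp_all add: not_multi_tiler_capped_cell)
  show "\<forall>n \<in> integer_points. fourier_indicator (capped_cell i j 0) n = fourier_indicator (capped_cell i j 1) n"
    using fourier_indicator_capped_cell[OF ij] by blast
  show "\<not> (\<exists>T. rigid_motion T \<and>
      sym_diff (T ` capped_cell i j 0) (capped_cell i j 1) \<in> null_sets lebesgue)"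
    using capped_cells_not_congruent[OF ij] by blast
qed

theorem theorem2p3:
  shows "(\<exists>P Q :: (real ^ 2) set.
           convex P \<and> centrally_symmetric P \<and> body P \<and> emeasure lebesgue P > 0 \<and> \<not> multi_tiler P \<and>
           convex Q \<and> centrally_symmetric Q \<and> body Q \<and> emeasure lebesgue Q > 0 \<and> \<not> multi_tiler Q \<and>
           (\<forall>n \<in> integer_points. fourier_indicator P n = fourier_indicator Q n) \<and>
           \<not> (\<exists>T. rigid_motion T \<and> sym_diff (T ` P) Q \<in> null_sets lebesgue)) \<and>
         (\<exists>P Q :: (real ^ 3) set.
           convex P \<and> centrally_symmetric P \<and> body P \<and> emeasure lebesgue P > 0 \<and> \<not> multi_tiler P \<and>
           convex Q \<and> centrally_symmetric Q \<and> body Q \<and> emeasure lebesgue Q > 0 \<and> \<not> multi_tiler Q \<and>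
           (\<forall>n \<in> integer_points. fourier_indicator P n = fourier_indicator Q n) \<and>
           \<not> (\<exists>T. rigid_motion T \<and> sym_diff (T ` P) Q \<in> null_sets lebesgue))"
  \<comment> \<open>The elements \<open>0\<close> and \<open>1\<close> of the index types
    \<open>2\<close> and \<open>3\<close> serve as \<open>i\<close> and \<open>j\<close>.\<close>
  by (rule conjI[OF exists_equal_integer_spectrum[OF zero_neq_one[where 'a = 2]]
      exists_equal_integer_spectrum[OF zero_neq_one[where 'a = 3]]])

end
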